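(* Let $(\Omega,+)$ be a semigroup. Then $(\mathcal{PT}_\Omega,<,>,\bullet)$ is a tridendriform algebra.
   Context: $\mathbb K$ is a fixed field. A planar rooted tree is a finite rooted tree in which the children of every vertex are linearly ordered from left to right. $\mathrm{PT}_\Omega$ is the set of (isomorphism classes of) non-empty planar rooted trees with vertices decorated by elements of $\Omega$, and $\mathcal{PT}_\Omega$ is the $\mathbb K$-vector space with basis $\mathrm{PT}_\Omega$. For $x\in\Omega$ and trees $T_1,\dots,T_k$ ($k\ge 0$), $B_+^x(T_1\cdots T_k)$ is the tree obtained by grafting $T_1,\dots,T_k$, in this order, on a new root decorated by $x$; it is extended multilinearly. $B_+^x(\emptyset)$ is the one-vertex tree decorated by $x$. Every tree is uniquely of the form $B_+^x(T_1\cdots T_k)$, $k\ge0$. The products $<,>,\bullet$ (and $\mathrm{qsh}^T:={<}+{>}+\bullet$) are the bilinear products on $\mathcal{PT}_\Omega$ defined on trees by induction on the total number of vertices: for $S=B_+^x(S_1\cdots S_k)$ and $T=B_+^y(T_1\cdots T_\ell)$, $$S<T:=B_+^x\big(S_1\cdots S_{k-1}(S_k\mathbin{\mathrm{qsh}^T}T)\big)\ (k\ge1),\qquad S<T:=B_+^x(T)\ (k=0),$$ $$S>T:=B_+^y\big((S\mathbin{\mathrm{qsh}^T}T_1)T_2\cdots T_\ell\big)\ (\ell\ge1),\qquad S>T:=B_+^y(S)\ (\ell=0),$$ $$S\bullet T:=B_+^{x+y}\big(S_1\cdots S_{k-1}(S_k\mathbin{\mathrm{qsh}^T}T_1)T_2\cdots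 T_\ell\big)\ (k,\ell\ge1),$$ and $S\bullet T:=B_+^{x+y}(T_1\cdots T_\ell)$ if $k=0$, $S\bullet T:=B_+^{x+y}(S_1\cdots S_k)$ if $\ell=0$. A tridendriform algebra is a vector space $A$ with three bilinear operations $\prec,\succ,\cdot$ such that, with $a*b:=a\prec b+a\succ b+a\cdot b$, for all $a,b,c\in A$: $(a\prec b)\prec c=a\prec(b*c)$; $(a\succ b)\prec c=a\succ(b\prec c)$; $(a*b)\succ c=a\succ(b\succ c)$; $(a\succ b)\cdot c=a\succ(b\cdot c)$; $(a\prec b)\cdot c=a\cdot(b\succ c)$; $(a\cdot b)\prec c=a\cdot(b\prec c)$; $(a\cdot b)\cdot c=a\cdot(b\cdot c)$. Here $<,>,\bullet$ play the roles of $\prec,\succ,\cdot$ respectively. *)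

theory Defs
  imports Complex_Main "HOL-Library.Poly_Mapping"
begin

locale tridendriform_algebra = vector_space scale
  for scale :: "'k::field \<Rightarrow> 'a::ab_group_add \<Rightarrow> 'a" +
  fixes lt gt dot :: "'a \<Rightarrow> 'a \<Rightarrow> 'a"
  assumes linear_lt_left: "\<And>b. Vector_Spaces.linear scale scale (\<lambda>a. lt a b)"
    and linear_lt_right: "\<And>a. Vector_Spaces.linear scale scale (\<lambda>b. lt a b)"
    and linear_gt_left: "\<And>b. Vector_Spaces.linear scale scale (\<lambda>a. gt a b)"
    and linear_gt_right: "\<And>a. Vector_Spaces.linear scale scale (\<lambda>b. gt a b)"
    and linear_dot_left: "\<And>b. Vector_Spaces.linear scale scale (\<lambda>a. dot a b)"
    and linear_dot_right: "\<And>a. Vector_Spaces.linear scale scale (\<lambda>b. dot a b)"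
    and lt_lt: "\<And>a b c. lt (lt a b) c = lt a (lt b c + gt b c + dot b c)"
    and gt_lt: "\<And>a b c. lt (gt a b) c = gt a (lt b c)"
    and gt_gt: "\<And>a b c. gt (lt a b + gt a b + dot a b) c = gt a (gt b c)"
    and gt_dot: "\<And>a b c. dot (gt a b) c = gt a (dot b c)"
    and lt_dot: "\<And>a b c. dot (lt a b) c = dot a (gt b c)"
    and dot_lt: "\<And>a b c. lt (dot a b) c = dot a (lt b c)"
    and dot_dot: "\<And>a b c. dot (dot a b) c = dot a (dot b c)"

datatype 'w ptree = Node 'w "'w ptree list"

text \<open>
  Finitely supported functions from trees to a field \<open>'k\<close> are the vector space with basis the
  set of trees; the basis vector of a tree \<open>t\<close> is \<open>Poly_Mapping.single t 1\<close>.
\<close>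

type_synonym ('w, 'k) PT = "'w ptree \<Rightarrow>\<^sub>0 'k"

definition scale_pm :: "'k::field \<Rightarrow> ('b \<Rightarrow>\<^sub>0 'k) \<Rightarrow> ('b \<Rightarrow>\<^sub>0 'k)"
  where "scale_pm c v = Poly_Mapping.map ((*) c) v"

abbreviation basis :: "'b \<Rightarrow> ('b \<Rightarrow>\<^sub>0 'k::field)"
  where "basis b \<equiv> Poly_Mapping.single b 1"

definition lin_ext :: "('b \<Rightarrow> ('c \<Rightarrow>\<^sub>0 'k::field)) \<Rightarrow> ('b \<Rightarrow>\<^sub>0 'k) \<Rightarrow> ('c \<Rightarrow>\<^sub>0 'k)"
  where "lin_ext f v = (\<Sum>b\<in>Poly_Mapping.keys v. scale_pm (Poly_Mapping.lookup v b) (f b))"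

definition bilin_ext ::
  "('b \<Rightarrow> 'b \<Rightarrow> ('c \<Rightarrow>\<^sub>0 'k::field)) \<Rightarrow> ('b \<Rightarrow>\<^sub>0 'k) \<Rightarrow> ('b \<Rightarrow>\<^sub>0 'k) \<Rightarrow> ('c \<Rightarrow>\<^sub>0 'k)"
  where "bilin_ext f u v = lin_ext (\<lambda>s. lin_ext (f s) v) u"

text \<open>A family of maps on \<open>n\<close>-tuples of basis elements, one for each \<open>n\<close>, is given as a map on lists.\<close>

fun multilin_ext :: "('b list \<Rightarrow> ('c \<Rightarrow>\<^sub>0 'k::field)) \<Rightarrow> ('b \<Rightarrow>\<^sub>0 'k) list \<Rightarrow> ('c \<Rightarrow>\<^sub>0 'k)" where
  "multilin_ext f [] = f []"
| "multilin_ext f (v # vs) = lin_ext (\<lambda>b. multilin_ext (\<lambda>bs. f (b # bs)) vs) v"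

definition Bplus :: "'w \<Rightarrow> ('w, 'k::field) PT list \<Rightarrow> ('w, 'k) PT"
  where "Bplus x vs = multilin_ext (\<lambda>ts. basis (Node x ts)) vs"

function lt_tree :: "'w::semigroup_add ptree \<Rightarrow> 'w ptree \<Rightarrow> ('w, 'k::field) PT"
  and gt_tree :: "'w ptree \<Rightarrow> 'w ptree \<Rightarrow> ('w, 'k) PT"
  and dot_tree :: "'w ptree \<Rightarrow> 'w ptree \<Rightarrow> ('w, 'k) PT"
  and qsh_tree :: "'w ptree \<Rightarrow> 'w ptree \<Rightarrow> ('w, 'k) PT"
where
  "lt_tree (Node x Ss) T =
     (if Ss = [] then Bplus x [basis T]
      else Bplus x (map basis (butlast Ss) @ [qsh_tree (last Ss) T]))"
| "gt_tree S (Node y Ts) =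
     (if Ts = [] then Bplus y [basis S]
      else Bplus y (qsh_tree S (hd Ts) # map basis (tl Ts)))"
| "dot_tree (Node x Ss) (Node y Ts) =
     (if Ss = [] then Bplus (x + y) (map basis Ts)
      else if Ts = [] then Bplus (x + y) (map basis Ss)
      else Bplus (x + y)
             (map basis (butlast Ss) @ [qsh_tree (last Ss) (hd Ts)] @ map basis (tl Ts)))"
| "qsh_tree S T = lt_tree S T + gt_tree S T + dot_tree S T"
  by pat_completeness auto

lemma size_last_hd_ptree:
  assumes "Ss \<noteq> []"
  shows "size (last Ss) < size (Node x Ss)" and "size (hd Ss) < size (Node x Ss)"
proof -
  have "size S < size (Node x Ss)" if "S \<in> set Ss" for S
    using size_list_estimation'[OF that order_refl, of size] by simp
  with assms show "size (last Ss) < size (Node x Ss)" "size (hd Ss) < size (Node x Ss)"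
    by auto
qed

text \<open>The quasi-shuffle calls the three products on the same trees, hence the extra \<open>1\<close> in its measure.\<close>

termination
proof (relation "measure (\<lambda>p. case p of
      Inl (Inl (S, T)) \<Rightarrow> 2 * (size S + size T)
    | Inl (Inr (S, T)) \<Rightarrow> 2 * (size S + size T)
    | Inr (Inl (S, T)) \<Rightarrow> 2 * (size S + size T)
    | Inr (Inr (S, T)) \<Rightarrow> 2 * (size S + size T) + 1)", goal_cases)
  case (4 x Ss y Ts)
  then show ?case
    using size_last_hd_ptree(1)[of Ss x] size_last_hd_ptree(2)[of Ts y] by simp
next
  case (2 x Ss T)
  then show ?case using size_last_hd_ptree(1)[of Ss x] by simp
next
  case (3 S y Ts)
  then show ?case using size_last_hd_ptree(2)[of Ts y] by simp
qed simp_all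

definition lt_PT :: "('w::semigroup_add, 'k::field) PT \<Rightarrow> ('w, 'k) PT \<Rightarrow> ('w, 'k) PT"
  where "lt_PT = bilin_ext lt_tree"

definition gt_PT :: "('w::semigroup_add, 'k::field) PT \<Rightarrow> ('w, 'k) PT \<Rightarrow> ('w, 'k) PT"
  where "gt_PT = bilin_ext gt_tree"

definition dot_PT :: "('w::semigroup_add, 'k::field) PT \<Rightarrow> ('w, 'k) PT \<Rightarrow> ('w, 'k) PT"
  where "dot_PT = bilin_ext dot_tree"

end

theory Submission
  imports Defs
begin

text \<open>
  The products have closed formulas on \<open>B\<^sub>+\<^sup>x(u\<^sub>1 \<dots> u\<^sub>k)\<close> for arbitrary vectors \<open>u\<^sub>i\<close>: they only
  touch the last (or first) argument, replacing it by a quasi-shuffle. With these formulas each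
  of the seven axioms, evaluated on trees \<open>S\<close>, \<open>T\<close>, \<open>U\<close>, is either immediate or reduces to the
  associativity of the quasi-shuffle on three trees with fewer vertices in total. As the seven
  axioms add up to that associativity, it follows by induction on the number of vertices.
\<close>

section \<open>Linear extension\<close>

lemma lookup_scale_pm [simp]:
  "Poly_Mapping.lookup (scale_pm c v) b = c * Poly_Mapping.lookup v b"
  by (simp add: scale_pm_def Poly_Mapping.map.rep_eq when_def)

interpretation pm: vector_space "scale_pm :: 'k::field \<Rightarrow> ('b \<Rightarrow>\<^sub>0 'k) \<Rightarrow> ('b \<Rightarrow>\<^sub>0 'k)"
  by unfold_locales (auto intro!: poly_mapping_eqI simp: lookup_add algebra_simps)

abbreviation pm_linear :: "(('b \<Rightarrow>\<^sub>0 'k::field) \<Rightarrow> ('c \<Rightarrow>\<^sub>0 'k)) \<Rightarrow> bool"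
  where "pm_linear \<equiv> Vector_Spaces.linear scale_pm scale_pm"

lemma pm_linearI:
  assumes "\<And>u v. L (u + v) = L u + L v" "\<And>c v. L (scale_pm c v) = scale_pm c (L v)"
  shows "pm_linear L"
  unfolding Vector_Spaces.linear_iff
  by (intro conjI allI assms pm.vector_space_axioms)

lemmas pm_linear_add = module_hom.add[OF Vector_Spaces.linear.axioms(3)]
lemmas pm_linear_scale = module_hom.scale[OF Vector_Spaces.linear.axioms(3)]
lemmas pm_linear_sum = module_hom.sum[OF Vector_Spaces.linear.axioms(3)]

lemma pm_linear_compose:
  assumes "pm_linear L" "pm_linear M"
  shows "pm_linear (\<lambda>v. L (M v))"
  by (rule pm_linearI)
    (simp_all only: pm_linear_add[OF assms(1)] pm_linear_add[OF assms(2)]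
      pm_linear_scale[OF assms(1)] pm_linear_scale[OF assms(2)])

text \<open>Vectors with different supports can then be summed over one common finite index set,
  where additivity and homogeneity are termwise.\<close>

lemma lin_ext_superset:
  assumes "finite A" "Poly_Mapping.keys v \<subseteq> A"
  shows "lin_ext f v = (\<Sum>b\<in>A. scale_pm (Poly_Mapping.lookup v b) (f b))"
  unfolding lin_ext_def using assms
  by (intro sum.mono_neutral_left) (auto simp: in_keys_iff)

lemma linear_lin_ext:
  fixes f :: "'b \<Rightarrow> ('c \<Rightarrow>\<^sub>0 'k::field)"
  shows "pm_linear (lin_ext f)"
proof (rule pm_linearI)
  fix u v :: "'b \<Rightarrow>\<^sub>0 'k"
  let ?A = "Poly_Mapping.keys u \<union> Poly_Mapping.keys v"
  have "lin_ext f w = (\<Sum>b\<in>?A. scale_pm (Poly_Mapping.lookup w b) (f b))"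
    if "w \<in> {u, v, u + v}" for w
    using that Poly_Mapping.keys_add[of u v] by (intro lin_ext_superset) auto
  then show "lin_ext f (u + v) = lin_ext f u + lin_ext f v"
    by (simp add: lookup_add pm.scale_left_distrib sum.distrib)
next
  fix c :: 'k and v :: "'b \<Rightarrow>\<^sub>0 'k"
  have "lin_ext f (scale_pm c v) =
      (\<Sum>b\<in>Poly_Mapping.keys v. scale_pm (Poly_Mapping.lookup (scale_pm c v) b) (f b))"
    by (intro lin_ext_superset) (auto simp: in_keys_iff)
  then show "lin_ext f (scale_pm c v) = scale_pm c (lin_ext f v)"
    by (simp add: lin_ext_def pm.scale_sum_right)
qed

lemma lin_ext_basis [simp]: "lin_ext f (basis b) = f b"
  by (simp add: lin_ext_def)

lemma lin_ext_basis_id: "lin_ext basis v = v"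
proof (rule poly_mapping_eqI)
  fix k
  have "Poly_Mapping.lookup (lin_ext basis v) k =
      (\<Sum>b\<in>Poly_Mapping.keys v. if b = k then Poly_Mapping.lookup v b else 0)"
    unfolding lin_ext_def lookup_sum
    by (rule sum.cong) (simp_all add: lookup_single when_def)
  also have "\<dots> = Poly_Mapping.lookup v k"
    by (simp add: in_keys_iff)
  finally show "Poly_Mapping.lookup (lin_ext basis v) k = Poly_Mapping.lookup v k" .
qed

lemma linear_of_lin_ext:
  assumes "pm_linear L"
  shows "L (lin_ext f v) = lin_ext (\<lambda>b. L (f b)) v"
  by (simp add: lin_ext_def pm_linear_sum[OF assms] pm_linear_scale[OF assms])

lemma linear_eq_lin_ext:
  assumes "pm_linear L"
  shows "L v = lin_ext (\<lambda>b. L (basis b)) v"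
  using linear_of_lin_ext[OF assms, of basis v] by (simp add: lin_ext_basis_id)

lemma linear_eqI:
  assumes "pm_linear L" "pm_linear M" "\<And>b. L (basis b) = M (basis b)"
  shows "L v = M v"
  unfolding linear_eq_lin_ext[OF assms(1), of v] linear_eq_lin_ext[OF assms(2), of v] assms(3) ..

lemma linear_bilin_ext_left: "pm_linear (\<lambda>u. bilin_ext f u v)"
  unfolding bilin_ext_def by (rule linear_lin_ext)

text \<open>Here the linearity is in the family of values, with the expanded vector \<open>u\<close>
  fixed. This is what handles every argument after the first in \<open>bilin_ext\<close> and
  \<open>multilin_ext\<close>.\<close>

lemma linear_lin_ext_fun:
  assumes "\<And>b. pm_linear (F b)"
  shows "pm_linear (\<lambda>v. lin_ext (\<lambda>b. F b v) u)"
  by (rule pm_linearI)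
    (simp_all add: lin_ext_def pm_linear_add[OF assms] pm_linear_scale[OF assms]
      pm.scale_right_distrib sum.distrib pm.scale_sum_right mult.commute)

lemma linear_bilin_ext_right: "pm_linear (bilin_ext f u)"
  unfolding bilin_ext_def by (intro linear_lin_ext_fun linear_lin_ext)

lemma bilin_ext_basis: "bilin_ext f (basis a) (basis b) = f a b"
  by (simp add: bilin_ext_def)

lemma linear_multilin_ext: "pm_linear (\<lambda>v. multilin_ext f (us @ v # vs))"
  by (induction us arbitrary: f) (simp_all add: linear_lin_ext linear_lin_ext_fun)

lemma multilin_ext_map_basis [simp]: "multilin_ext f (map basis bs) = f bs"
  by (induction bs arbitrary: f) simp_all

lemma multilinear_eqI:
  assumes F: "\<And>us vs. pm_linear (\<lambda>v. F (us @ v # vs))"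
    and G: "\<And>us vs. pm_linear (\<lambda>v. G (us @ v # vs))"
    and eq: "\<And>bs. F (map basis bs) = G (map basis bs)"
  shows "F vs = G vs"
proof -
  \<comment> \<open>Linearity turns the first remaining argument into a basis vector, which then
    joins the prefix \<open>map basis bs\<close>; so the prefix must be arbitrary in the
    induction.\<close>
  have "F (map basis bs @ vs) = G (map basis bs @ vs)" for bs
  proof (induction vs arbitrary: bs)
    case (Cons v vs)
    show ?case
    proof (rule linear_eqI[OF F G])
      fix b
      show "F (map basis bs @ basis b # vs) = G (map basis bs @ basis b # vs)"
        using Cons.IH[of "bs @ [b]"] by simp
    qed
  qed (simp add: eq)
  from this[of "[]"] show ?thesis by simp
qed

lemma bilinear_eqI:
  assumes "\<And>v. pm_linear (\<lambda>u. F u v)" "\<And>u. pm_linear (F u)"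
    and "\<And>v. pm_linear (\<lambda>u. G u v)" "\<And>u. pm_linear (G u)"
    and "\<And>a b. F (basis a) (basis b) = G (basis a) (basis b)"
  shows "F u v = G u v"
  by (rule linear_eqI[OF assms(1,3)], rule linear_eqI[OF assms(2,4)], rule assms(5))

lemma trilinear_eqI:
  assumes "\<And>v w. pm_linear (\<lambda>u. F u v w)" "\<And>u w. pm_linear (\<lambda>v. F u v w)"
    "\<And>u v. pm_linear (F u v)"
    and "\<And>v w. pm_linear (\<lambda>u. G u v w)" "\<And>u w. pm_linear (\<lambda>v. G u v w)"
    "\<And>u v. pm_linear (G u v)"
    and "\<And>a b c. F (basis a) (basis b) (basis c) = G (basis a) (basis b) (basis c)"
  shows "F = G"
  by (intro ext, rule linear_eqI[OF assms(1,4)], rule bilinear_eqI[OF assms(2,3,5,6)],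
      rule assms(7))

section \<open>The products of grafted vectors\<close>

text \<open>Taken as a sum of products, not as the bilinear extension of \<open>qsh_tree\<close>, so
  that it folds the sums in the axioms; \<open>products_basis\<close> shows agreement on
  trees.\<close>

definition qsh_PT :: "('w::semigroup_add, 'k::field) PT \<Rightarrow> ('w, 'k) PT \<Rightarrow> ('w, 'k) PT"
  where "qsh_PT u v = lt_PT u v + gt_PT u v + dot_PT u v"

lemma linear_products:
  "pm_linear (\<lambda>u. lt_PT u v)" "pm_linear (lt_PT u)"
  "pm_linear (\<lambda>u. gt_PT u v)" "pm_linear (gt_PT u)"
  "pm_linear (\<lambda>u. dot_PT u v)" "pm_linear (dot_PT u)"
  unfolding lt_PT_def gt_PT_def dot_PT_def
  by (rule linear_bilin_ext_left linear_bilin_ext_right)+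

lemma linear_qsh_PT: "pm_linear (\<lambda>u. qsh_PT u v)" "pm_linear (qsh_PT u)"
  by (rule pm_linearI; simp add: qsh_PT_def linear_products[THEN pm_linear_add]
      linear_products[THEN pm_linear_scale] pm.scale_right_distrib)+

lemma pm_linear_ident: "pm_linear (\<lambda>v. v)"
  by (rule pm_linearI) simp_all

lemmas linear_compose_products =
  linear_products[THEN pm_linear_compose] linear_qsh_PT[THEN pm_linear_compose]

lemma linear_Bplus:
  assumes "pm_linear L"
  shows "pm_linear (\<lambda>v. Bplus x (us @ L v # vs))"
  unfolding Bplus_def by (rule pm_linear_compose[OF linear_multilin_ext assms])

text \<open>The instances cover the syntactic shapes of the argument list around the varying entry,
  so that \<open>intro\<close> can find that entry.\<close>

lemmas linear_intros = pm_linear_ident linear_compose_products linear_Bplus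
  linear_Bplus[where us = "[]", simplified]
  linear_Bplus[where us = "u # us" for u us, simplified]
  linear_Bplus[where us = "us @ u # us'" for us u us', simplified]

lemma Bplus_map_basis: "Bplus x (map basis ts) = basis (Node x ts)"
  by (simp add: Bplus_def)

lemma products_basis:
  "lt_PT (basis s) (basis t) = lt_tree s t"
  "gt_PT (basis s) (basis t) = gt_tree s t"
  "dot_PT (basis s) (basis t) = dot_tree s t"
  "qsh_PT (basis s) (basis t) = qsh_tree s t"
  by (simp_all add: lt_PT_def gt_PT_def dot_PT_def qsh_PT_def bilin_ext_basis qsh_tree.simps)

declare lt_tree.simps [simp del] gt_tree.simps [simp del] dot_tree.simps [simp del]
  qsh_tree.simps [simp del]

lemma lt_Bplus_Nil: "lt_PT (Bplus x []) v = Bplus x [v]"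
proof (rule linear_eqI[of "\<lambda>v. lt_PT (Bplus x []) v"])
  show "lt_PT (Bplus x []) (basis t) = Bplus x [basis t]" for t
    by (simp add: Bplus_map_basis[of x "[]", simplified] products_basis lt_tree.simps)
qed (intro linear_intros)+

lemma gt_Bplus_Nil: "gt_PT u (Bplus y []) = Bplus y [u]"
proof (rule linear_eqI[of "\<lambda>u. gt_PT u (Bplus y [])"])
  show "gt_PT (basis s) (Bplus y []) = Bplus y [basis s]" for s
    by (simp add: Bplus_map_basis[of y "[]", simplified] products_basis gt_tree.simps)
qed (intro linear_intros)+

text \<open>Both sides are linear in each of \<open>us\<close>, \<open>u\<close> and
  \<open>v\<close>, so trees suffice, and there this is the defining equation of
  \<open>lt_tree\<close>. The other formulas below follow the same pattern.\<close>

lemma lt_Bplus_snoc: "lt_PT (Bplus x (us @ [u])) v = Bplus x (us @ [qsh_PT u v])"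
proof (rule multilinear_eqI[of "\<lambda>us. lt_PT (Bplus x (us @ [u])) v"], goal_cases)
  case (3 ss)
  show ?case
  proof (rule bilinear_eqI[of "\<lambda>u v. lt_PT (Bplus x (map basis ss @ [u])) v"], goal_cases)
    case (5 s t)
    show ?case
      by (simp add: Bplus_map_basis[of x "ss @ [s]", simplified] products_basis lt_tree.simps)
  qed (intro linear_intros)+
\<comment> \<open>Reassociation brings \<open>(us @ v # vs) @ [u]\<close> into the shape expected by
  \<open>linear_intros\<close>.\<close>
qed (simp only: append_assoc append_Cons append_Nil, intro linear_intros)+

lemma gt_Bplus_Cons: "gt_PT u (Bplus y (v # vs)) = Bplus y (qsh_PT u v # vs)"
proof (rule multilinear_eqI[of "\<lambda>vs. gt_PT u (Bplus y (v # vs))"], goal_cases)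
  case (3 ts)
  show ?case
  proof (rule bilinear_eqI[of "\<lambda>u v. gt_PT u (Bplus y (v # map basis ts))"], goal_cases)
    case (5 s t)
    show ?case
      by (simp add: Bplus_map_basis[of y "t # ts", simplified] products_basis gt_tree.simps)
  qed (intro linear_intros)+
qed (intro linear_intros)+

lemma dot_Bplus_Nil_left: "dot_PT (Bplus x []) (Bplus y vs) = Bplus (x + y) vs"
proof (rule multilinear_eqI[of "\<lambda>vs. dot_PT (Bplus x []) (Bplus y vs)"], goal_cases)
  case (3 ts)
  show ?case
    by (simp add: Bplus_map_basis[of x "[]", simplified] Bplus_map_basis[of y ts]
        products_basis dot_tree.simps)
qed (intro linear_intros)+

lemma dot_Bplus_Nil_right: "dot_PT (Bplus x us) (Bplus y []) = Bplus (x + y) us"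
proof (rule multilinear_eqI[of "\<lambda>us. dot_PT (Bplus x us) (Bplus y [])"], goal_cases)
  case (3 ss)
  show ?case
    by (simp add: Bplus_map_basis[of y "[]", simplified] Bplus_map_basis[of x ss]
        products_basis dot_tree.simps)
qed (intro linear_intros)+

lemma dot_Bplus_snoc_Cons:
  "dot_PT (Bplus x (us @ [u])) (Bplus y (v # vs)) = Bplus (x + y) (us @ qsh_PT u v # vs)"
proof (rule multilinear_eqI[of "\<lambda>us. dot_PT (Bplus x (us @ [u])) (Bplus y (v # vs))"],
    goal_cases)
  case (3 ss)
  show ?case
  proof (rule multilinear_eqI[of "\<lambda>vs. dot_PT (Bplus x (map basis ss @ [u])) (Bplus y (v # vs))"],
      goal_cases)
    case (3 ts)
    show ?case
    proof (rule bilinear_eqI[of "\<lambda>u v. dot_PT (Bplus x (map basis ss @ [u]))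
          (Bplus y (v # map basis ts))"], goal_cases)
      case (5 s t)
      show ?case
        by (simp add: Bplus_map_basis[of x "ss @ [s]", simplified]
            Bplus_map_basis[of y "t # ts", simplified] products_basis dot_tree.simps)
    qed (intro linear_intros)+
  qed (intro linear_intros)+
qed (simp only: append_assoc append_Cons append_Nil, intro linear_intros)+

section \<open>The tridendriform axioms\<close>

lemmas products_Bplus = lt_Bplus_Nil gt_Bplus_Nil lt_Bplus_snoc gt_Bplus_Cons
  dot_Bplus_Nil_left dot_Bplus_Nil_right dot_Bplus_snoc_Cons
  lt_Bplus_snoc[where us = "[]", simplified]
  lt_Bplus_snoc[where us = "u # us" for u us, simplified]
  lt_Bplus_snoc[where us = "us @ u # us'" for us u us', simplified]
  dot_Bplus_snoc_Cons[where us = "[]", simplified]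
  dot_Bplus_snoc_Cons[where us = "u # us" for u us, simplified]
  dot_Bplus_snoc_Cons[where us = "us @ u # us'" for us u us', simplified]

text \<open>Bundled at a single triple, because the induction needs all seven identities at smaller
  triples to obtain associativity there.\<close>

definition tridendriform_at ::
  "('w::semigroup_add, 'k::field) PT \<Rightarrow> ('w, 'k) PT \<Rightarrow> ('w, 'k) PT \<Rightarrow> bool"
  where "tridendriform_at a b c \<longleftrightarrow>
    lt_PT (lt_PT a b) c = lt_PT a (qsh_PT b c) \<and>
    lt_PT (gt_PT a b) c = gt_PT a (lt_PT b c) \<and>
    gt_PT (qsh_PT a b) c = gt_PT a (gt_PT b c) \<and>
    dot_PT (gt_PT a b) c = gt_PT a (dot_PT b c) \<and>
    dot_PT (lt_PT a b) c = dot_PT a (gt_PT b c) \<and>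
    lt_PT (dot_PT a b) c = dot_PT a (lt_PT b c) \<and>
    dot_PT (dot_PT a b) c = dot_PT a (dot_PT b c)"

text \<open>Expanding by bilinearity, but keeping \<open>gt_PT (qsh_PT a b) c\<close> and
  \<open>lt_PT a (qsh_PT b c)\<close> whole, leaves the seven left sides of the axioms against the
  seven right sides.\<close>

lemma qsh_assoc_if_tridendriform_at:
  assumes "tridendriform_at a b c"
  shows "qsh_PT (qsh_PT a b) c = qsh_PT a (qsh_PT b c)"
proof -
  have "qsh_PT (qsh_PT a b) c =
      lt_PT (lt_PT a b) c + lt_PT (gt_PT a b) c + lt_PT (dot_PT a b) c + gt_PT (qsh_PT a b) c +
      (dot_PT (lt_PT a b) c + dot_PT (gt_PT a b) c + dot_PT (dot_PT a b) c)"
    unfolding qsh_PT_def[of "qsh_PT a b" c]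
    by (simp add: qsh_PT_def[of a b] linear_products[THEN pm_linear_add])
  moreover have "qsh_PT a (qsh_PT b c) =
      lt_PT a (qsh_PT b c) + (gt_PT a (lt_PT b c) + gt_PT a (gt_PT b c) + gt_PT a (dot_PT b c)) +
      (dot_PT a (lt_PT b c) + dot_PT a (gt_PT b c) + dot_PT a (dot_PT b c))"
    unfolding qsh_PT_def[of a "qsh_PT b c"]
    by (simp add: qsh_PT_def[of b c] linear_products[THEN pm_linear_add])
  ultimately show ?thesis
    using assms by (simp add: tridendriform_at_def ac_simps)
qed

text \<open>Whole factors occur in \<open>assoc\<close> because, for example,
  \<open>lt_PT (lt_PT a b) c\<close> associates the last argument of \<open>a\<close> with all of
  \<open>b\<close> and \<open>c\<close>. The final disjunction guarantees a descent in at least one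
  position.\<close>

lemma tridendriform_at_Bplus:
  assumes assoc: "\<And>u v w. u \<in> insert (Bplus x us) (set us) \<Longrightarrow>
      v \<in> insert (Bplus y vs) (set vs) \<Longrightarrow> w \<in> insert (Bplus z ws) (set ws) \<Longrightarrow>
      u \<in> set us \<or> v \<in> set vs \<or> w \<in> set ws \<Longrightarrow>
      qsh_PT (qsh_PT u v) w = qsh_PT u (qsh_PT v w)"
  shows "tridendriform_at (Bplus x us) (Bplus y vs) (Bplus z ws)"
proof -
  have us: "us = [] \<or> (\<exists>us' u. us = us' @ [u])"
    by (cases us rule: rev_cases) auto
  have ws: "ws = [] \<or> (\<exists>w ws'. ws = w # ws')"
    by (cases ws) auto
  \<comment> \<open>The middle factor can be modified at both ends. With one argument both
    modifications hit the same entry and need \<open>assoc\<close>; with two or more they are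
    independent. For the outer factors only one end matters.\<close>
  consider "vs = []" | v where "vs = [v]" | v vs' v' where "vs = v # vs' @ [v']"
    by (metis rev_exhaust append_Cons append_Nil list.exhaust)
  then show ?thesis
    using us ws
    by cases (elim disjE exE; simp add: tridendriform_at_def products_Bplus assoc add.assoc)+
qed

lemma tridendriform_at_basis:
  "tridendriform_at (basis S :: ('w::semigroup_add, 'k::field) PT) (basis T) (basis U)"
proof (induction "size S + size T + size U" arbitrary: S T U rule: less_induct)
  case less
  obtain x Ss y Ts z Us where eqs: "S = Node x Ss" "T = Node y Ts" "U = Node z Us"
    by (metis ptree.exhaust)
  \<comment> \<open>\<open>size\<close> is not exactly the number of vertices, since
    \<open>size_list\<close> adds one per list entry, but it still decreases from a tree to its
    children.\<close>
  have child: "size s < size (Node x ss)" if "s \<in> set ss" for s ss and x :: 'w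
    using size_list_estimation'[OF that order_refl, of size] by simp
  have "tridendriform_at (Bplus x (map basis Ss) :: ('w, 'k) PT)
      (Bplus y (map basis Ts)) (Bplus z (map basis Us))"
  proof (rule tridendriform_at_Bplus, unfold Bplus_map_basis, fold eqs)
    fix u v w :: "('w, 'k) PT"
    assume *: "u \<in> insert (basis S) (set (map basis Ss))"
      "v \<in> insert (basis T) (set (map basis Ts))"
      "w \<in> insert (basis U) (set (map basis Us))"
      "u \<in> set (map basis Ss) \<or> v \<in> set (map basis Ts) \<or> w \<in> set (map basis Us)"
    have sub: "\<exists>s'. u = basis s' \<and> size s' \<le> size (Node x ss) \<and>
        (u \<in> set (map basis ss) \<longrightarrow> size s' < size (Node x ss))"
      if "u \<in> insert (basis (Node x ss)) (set (map basis ss))" for u :: "('w, 'k) PT" and x ss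
      using that child[of _ ss x] by (cases "u \<in> set (map basis ss)") (auto intro: less_imp_le)
    \<comment> \<open>No tree is larger than the one it replaces, and by the last fact in
      \<open>*\<close> one is a proper child, so the total size drops and the induction hypothesis
      applies.\<close>
    obtain s t r where "u = basis s" "v = basis t" "w = basis r"
      and "size s + size t + size r < size S + size T + size U"
      using sub[OF *(1)[unfolded eqs]] sub[OF *(2)[unfolded eqs]] sub[OF *(3)[unfolded eqs]] *(4)
      unfolding eqs by (metis add_less_le_mono add_le_less_mono add_mono)
    then show "qsh_PT (qsh_PT u v) w = qsh_PT u (qsh_PT v w)"
      using qsh_assoc_if_tridendriform_at[OF less] by simp
  qed
  then show ?case
    by (simp add: Bplus_map_basis eqs)
qed

text \<open>Stated between functions so that unification with \<open>trilinear_eqI\<close> reads off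
  \<open>F\<close> and \<open>G\<close> directly.\<close>

lemma tridendriform_axioms:
  "(\<lambda>a b c :: ('w::semigroup_add, 'k::field) PT. lt_PT (lt_PT a b) c) =
    (\<lambda>a b c. lt_PT a (qsh_PT b c))"
  "(\<lambda>a b c :: ('w, 'k) PT. lt_PT (gt_PT a b) c) = (\<lambda>a b c. gt_PT a (lt_PT b c))"
  "(\<lambda>a b c :: ('w, 'k) PT. gt_PT (qsh_PT a b) c) = (\<lambda>a b c. gt_PT a (gt_PT b c))"
  "(\<lambda>a b c :: ('w, 'k) PT. dot_PT (gt_PT a b) c) = (\<lambda>a b c. gt_PT a (dot_PT b c))"
  "(\<lambda>a b c :: ('w, 'k) PT. dot_PT (lt_PT a b) c) = (\<lambda>a b c. dot_PT a (gt_PT b c))"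
  "(\<lambda>a b c :: ('w, 'k) PT. lt_PT (dot_PT a b) c) = (\<lambda>a b c. dot_PT a (lt_PT b c))"
  "(\<lambda>a b c :: ('w, 'k) PT. dot_PT (dot_PT a b) c) = (\<lambda>a b c. dot_PT a (dot_PT b c))"
  by (rule trilinear_eqI; (intro linear_intros)?;
      simp add: tridendriform_at_basis[unfolded tridendriform_at_def])+

theorem proposition17:
  shows "tridendriform_algebra
    (scale_pm :: 'k::field \<Rightarrow> ('w::semigroup_add, 'k) PT \<Rightarrow> ('w, 'k) PT)
    lt_PT gt_PT dot_PT"
proof (intro tridendriform_algebra.intro tridendriform_algebra_axioms.intro linear_products)
  show "vector_space (scale_pm :: 'k \<Rightarrow> ('w, 'k) PT \<Rightarrow> ('w, 'k) PT)"
    by (rule pm.vector_space_axioms)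
qed (simp_all only: tridendriform_axioms[THEN fun_cong, THEN fun_cong, THEN fun_cong]
    flip: qsh_PT_def)

end
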